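(* Consider a convex scenario program (as described in the context) satisfying the Feasibility-and-Uniqueness and Non-Degeneracy assumptions, with support-constraint bound $\zeta$, let $N>\zeta$ and $M$ be the numbers of design and validation scenarios, and assume that $\{\delta^{(1)},\dots,\delta^{(N)},\tilde\delta^{(1)},\dots,\tilde\delta^{(M)}\}$ are sampled from the product probability space $(\Delta^{N+M},\mathcal{F}^{N+M},\mathbb{P}^{N+M})$. Let $\epsilon(k,l)$, $k\in\{0,\dots,\zeta\}$, $l\in\{0,\dots,M\}$, be an arbitrary $[0,1]$-valued function. Then $$\mathbb{P}^{N+M}\left\{V(\mathbf{x}_N^* )>\epsilon(s_N^*,r_M^* )\right\}\le\beta^*,$$ where $\beta^*$ is the optimal value of the variational problem $$\inf_{g\in \mathbf{C}^{\zeta}[0,1]} g(1)$$ subject to $$\binom{N}{k}t^{N-k}\cdot\sum_{l=0}^M\binom{M}{l}t^{M-l}(1-t)^l\cdot\mathbf{1}_{[0,1-\epsilon(k,l))}(t)\le\frac{1}{k!}\frac{\mathrm{d}^k}{\mathrm{d}t^k}g(t),\quad\forall t\in[0,1],\ \forall k\in\{0,\dots,\zeta\}.$$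
   Context: Scenario setting. $(\Delta,\mathcal{F},\mathbb{P})$ is a probability space; $(\Delta^m,\mathcal{F}^m,\mathbb{P}^m)$ is its $m$-fold product, so samples are independent with law $\mathbb{P}$. $\mathcal{X}\subseteq\mathbb{R}^d$ is convex and closed, $J:\mathbb{R}^d\to\mathbb{R}$ is convex, and $f(\mathbf{x},\delta)$ is lower semi-continuous and convex in $\mathbf{x}\in\mathbb{R}^d$ for each fixed $\delta\in\Delta$. For $\omega_m=\{\delta^{(1)},\dots,\delta^{(m)}\}\in\Delta^m$, the scenario program $\mathrm{SP}_m[\omega_m]$ is: minimize $J(\mathbf{x})$ over $\mathbf{x}\in\mathcal{X}$ subject to $f(\mathbf{x},\delta^{(i)})\le0$ for $i=1,\dots,m$ (for $m=0$ there are no scenario constraints). Feasibility and Uniqueness: for every $m\ge0$ and every $\omega_m\in\Delta^m$, the optimal solution $\mathbf{x}_m^*$ of $\mathrm{SP}_m[\omega_m]$ exists and is unique. Violation probability: $V(\mathbf{x})=\mathbb{P}\{\delta\in\Delta: f(\mathbf{x},\delta)>0\}$. The usual measurability of $V(\mathbf{x}_m^* )$ and of the other random quantities involved is assumed. Support constraint: a scenario constraint of $\mathrm{SP}_m[\omega_m]$ whose removal yields a different optimal solution. $s_m^*$ denotes the number of support constraints of $\mathrm{SP}_m[\omega_m]$. Non-Degeneracy: for every $m$, with probability one the solution of $\mathrm{SP}_m[\omega_m]$ coincides with the solution of the program defined by its support constraints only. $\zeta\le d$ is an integer such that, with probability one, the number of support constraints of $\mathrm{SP}_m[\omega_m]$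 is at most $\zeta$ for every $m$ (e.g. Helly's dimension or a tighter bound). $\mathbf{x}_N^*$ is the solution of the program $\mathrm{SP}_N$ built from $\delta^{(1)},\dots,\delta^{(N)}$, $s_N^*$ is its number of support constraints, and $r_M^*=\sum_{l=1}^M\mathbf{1}_{\{\delta: f(\mathbf{x}_N^*,\delta)>0\}}(\tilde\delta^{(l)})$ is the number of validation scenarios violated by $\mathbf{x}_N^*$. $\mathbf{C}^{q}[0,1]$ is the class of $q$ times differentiable functions on $[0,1]$ with continuous $q$-th derivative; $\mathbf{1}_S$ is the indicator function of $S$. *)

theory Defs
  imports "HOL-Probability.Probability"
begin

definition lower_semicontinuous :: "('a::topological_space \<Rightarrow> real) \<Rightarrow> bool" where
  "lower_semicontinuous h \<longleftrightarrow> (\<forall>x. \<forall>c < h x. \<forall>\<^sub>F y in nhds x. c < h y)"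

(* A scenario program is given by a finite set I of indices and a family w of scenarios, of which
   only the w i with i in I matter: SP_m[w] is the program with I = {..<m}.  Constraints are
   identified by their index, so repeated scenarios count as different constraints, and
   constraint i is removed by passing from I to I - {i}. *)

definition sp_feasible ::
  "'a set \<Rightarrow> ('a \<Rightarrow> 'd \<Rightarrow> real) \<Rightarrow> nat set \<Rightarrow> (nat \<Rightarrow> 'd) \<Rightarrow> 'a set" where
  "sp_feasible X f I w = {x \<in> X. \<forall>i\<in>I. f x (w i) \<le> 0}"

definition sp_optimal ::
  "'a set \<Rightarrow> ('a \<Rightarrow> real) \<Rightarrow> ('a \<Rightarrow> 'd \<Rightarrow> real) \<Rightarrow> nat set \<Rightarrow> (nat \<Rightarrow> 'd) \<Rightarrow> 'a \<Rightarrow> bool" where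
  "sp_optimal X J f I w x \<longleftrightarrow> is_arg_min J (\<lambda>y. y \<in> sp_feasible X f I w) x"

(* Meaningful only when the optimal solution exists and is unique. *)
definition sp_solution ::
  "'a set \<Rightarrow> ('a \<Rightarrow> real) \<Rightarrow> ('a \<Rightarrow> 'd \<Rightarrow> real) \<Rightarrow> nat set \<Rightarrow> (nat \<Rightarrow> 'd) \<Rightarrow> 'a" where
  "sp_solution X J f I w = (THE x. sp_optimal X J f I w x)"

definition support_constraints ::
  "'a set \<Rightarrow> ('a \<Rightarrow> real) \<Rightarrow> ('a \<Rightarrow> 'd \<Rightarrow> real) \<Rightarrow> nat set \<Rightarrow> (nat \<Rightarrow> 'd) \<Rightarrow> nat set" where
  "support_constraints X J f I w =
     {i \<in> I. sp_solution X J f (I - {i}) w \<noteq> sp_solution X J f I w}"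

definition violation_set :: "'d measure \<Rightarrow> ('a \<Rightarrow> 'd \<Rightarrow> real) \<Rightarrow> 'a \<Rightarrow> 'd set" where
  "violation_set P f x = {\<delta> \<in> space P. f x \<delta> > 0}"

definition violation_prob :: "'d measure \<Rightarrow> ('a \<Rightarrow> 'd \<Rightarrow> real) \<Rightarrow> 'a \<Rightarrow> real" where
  "violation_prob P f x = measure P (violation_set P f x)"

definition num_violated ::
  "'d measure \<Rightarrow> ('a \<Rightarrow> 'd \<Rightarrow> real) \<Rightarrow> nat \<Rightarrow> (nat \<Rightarrow> 'd) \<Rightarrow> 'a \<Rightarrow> nat" where
  "num_violated P f M v x = (\<Sum>l<M. indicator (violation_set P f x) (v l))"

(* Derivatives are taken within [0,1], hence one-sided at the end points. *)
primrec nth_deriv01 :: "nat \<Rightarrow> (real \<Rightarrow> real) \<Rightarrow> real \<Rightarrow> real" where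
  "nth_deriv01 0 g = g"
| "nth_deriv01 (Suc k) g = (\<lambda>t. vector_derivative (nth_deriv01 k g) (at t within {0..1}))"

definition C01 :: "nat \<Rightarrow> (real \<Rightarrow> real) set" where
  "C01 q = {g. (\<forall>k<q. nth_deriv01 k g differentiable_on {0..1}) \<and>
               continuous_on {0..1} (nth_deriv01 q g)}"

definition var_feasible ::
  "nat \<Rightarrow> nat \<Rightarrow> nat \<Rightarrow> (nat \<Rightarrow> nat \<Rightarrow> real) \<Rightarrow> (real \<Rightarrow> real) set" where
  "var_feasible \<zeta> N M \<epsilon> =
     {g \<in> C01 \<zeta>. \<forall>t\<in>{0..1}. \<forall>k\<le>\<zeta>.
        real (N choose k) * t ^ (N - k) *
          (\<Sum>l=0..M. real (M choose l) * t ^ (M - l) * (1 - t) ^ l * indicator {0..<1 - \<epsilon> k l} t)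
        \<le> 1 / fact k * nth_deriv01 k g t}"

(* For N > zeta and [0,1]-valued epsilon the infimum is over a nonempty set (large multiples of exp
   are feasible) that is bounded below (the constraint k = 0, t = 1 reads 0 <= g 1), so the real
   Inf is the true optimal value. *)
definition beta_star :: "nat \<Rightarrow> nat \<Rightarrow> nat \<Rightarrow> (nat \<Rightarrow> nat \<Rightarrow> real) \<Rightarrow> real" where
  "beta_star \<zeta> N M \<epsilon> = (INF g \<in> var_feasible \<zeta> N M \<epsilon>. g 1)"

end

theory Submission
  imports Defs
begin

text \<open>
  Let \<open>\<nu> k\<close> be the law of \<open>1 - V(x\<^sub>k)\<close> on the event that all \<open>k\<close> constraints of \<open>SP\<^sub>k\<close> are of support.
  By non-degeneracy, a set \<open>S\<close> of \<open>k\<close> indices is almost surely the support set of \<open>SP\<^sub>m\<close> iff all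
  constraints of the program on \<open>S\<close> are of support and its solution, which then is \<open>x\<^sub>m\<close>, satisfies
  the other \<open>m - k\<close> constraints. Given the scenarios in \<open>S\<close> this has probability \<open>t ^ (m - k)\<close> with
  \<open>t = 1 - V\<close>. Summing over all \<open>S\<close> gives
  \<open>(\<Sum>k\<le>\<zeta>. (m choose k) * \<integral>t. t ^ (m - k) \<partial>\<nu> k) = 1\<close> for every \<open>m\<close>, that is
  \<open>(\<Sum>k\<le>\<zeta>. \<integral>t. g\<^bsup>(k)\<^esup>(t) / k! \<partial>\<nu> k) = g 1\<close> for monomials \<open>g\<close>. This extends to polynomials by
  linearity, and to \<open>C\<^sup>\<zeta>\<close> functions since polynomials approximate them uniformly together with their
  first \<open>\<zeta>\<close> derivatives. As the probability in question is the sum over \<open>k\<close> of the \<open>\<nu> k\<close>-integrals of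
  the left-hand sides of the constraints of the variational problem, it is at most \<open>g 1\<close> for every
  feasible \<open>g\<close>.
\<close>

section \<open>Derivatives on the unit interval, polynomial approximation and weak duality\<close>

lemma C01_has_real_derivative:
  assumes "g \<in> C01 q" "k < q" "t \<in> {0..1}"
  shows "(nth_deriv01 k g has_real_derivative nth_deriv01 (Suc k) g t) (at t within {0..1})"
  using assms
  by (auto simp: C01_def differentiable_on_def has_real_derivative_iff_has_vector_derivative
      vector_derivative_works[symmetric])

text \<open>Multiples of \<open>exp\<close> reproduce themselves under differentiation; they later
  witness that \<open>var_feasible\<close> is nonempty. The restriction on \<open>t\<close> matters:
  outside the interval the filter \<open>at t within {0..1}\<close> is trivial and
  \<open>vector_derivative\<close> is arbitrary.\<close>

lemma nth_deriv01_scaled_exp: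
  assumes "t \<in> {0..1}"
  shows "nth_deriv01 k (\<lambda>x. C * exp x) t = C * exp t"
  using assms
proof (induction k arbitrary: t)
  case (Suc k)
  have "((\<lambda>x. C * exp x) has_vector_derivative C * exp t) (at t within {0..1})"
    by (auto intro!: derivative_eq_intros simp flip: has_real_derivative_iff_has_vector_derivative)
  then have "(nth_deriv01 k (\<lambda>x. C * exp x) has_vector_derivative C * exp t) (at t within {0..1})"
    by (rule has_vector_derivative_transform[rotated 2]) (use Suc in auto)
  then show ?case
    using Suc.prems by (simp add: vector_derivative_within_closed_interval)
qed simp

lemma scaled_exp_in_C01: "(\<lambda>x. C * exp x) \<in> C01 q"
proof -
  have "nth_deriv01 k (\<lambda>x. C * exp x) differentiable_on {0..1}" for k
    unfolding differentiable_on_def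
  proof
    fix t :: real assume t: "t \<in> {0..1}"
    have "((\<lambda>x. C * exp x) has_vector_derivative C * exp t) (at t within {0..1})"
      by (auto intro!: derivative_eq_intros simp flip: has_real_derivative_iff_has_vector_derivative)
    then have "(nth_deriv01 k (\<lambda>x. C * exp x) has_vector_derivative C * exp t) (at t within {0..1})"
      by (rule has_vector_derivative_transform[rotated 2]) (use t in \<open>auto simp: nth_deriv01_scaled_exp\<close>)
    then show "nth_deriv01 k (\<lambda>x. C * exp x) differentiable at t within {0..1}"
      by (rule differentiableI_vector)
  qed
  then show ?thesis
    by (auto simp: C01_def intro: differentiable_imp_continuous_on)
qed

text \<open>The \<open>k\<close>-th derivative of \<open>t ^ m\<close> is
  \<open>fact k * (m choose k) * t ^ (m - k)\<close>; for \<open>m < k\<close> the binomial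
  coefficient vanishes and makes the truncated exponent harmless. Stone-Weierstrass settles
  \<open>q = 0\<close>. In the induction step the polynomial that serves the family starting at
  \<open>H 1\<close> is integrated: on an interval of length 1 this does not enlarge a uniform
  error, so the same \<open>\<eta>\<close> serves at every order.\<close>

lemma polynomial_approximates_derivatives:
  fixes H :: "nat \<Rightarrow> real \<Rightarrow> real"
  assumes "\<And>k t. k < q \<Longrightarrow> t \<in> {0..1} \<Longrightarrow>
      (H k has_real_derivative H (Suc k) t) (at t within {0..1})"
    and "continuous_on {0..1} (H q)" and "0 < \<eta>"
  shows "\<exists>c n. \<forall>k\<le>q. \<forall>t\<in>{0..1}.
      \<bar>H k t - fact k * (\<Sum>m\<le>n. c m * real (m choose k) * t ^ (m - k))\<bar> \<le> \<eta>"
  using assms(1,2)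
proof (induction q arbitrary: H)
  case 0
  obtain p where p: "real_polynomial_function p" "\<And>t. t \<in> {0..1} \<Longrightarrow> \<bar>H 0 t - p t\<bar> < \<eta>"
    using Stone_Weierstrass_real_polynomial_function[OF compact_Icc 0(2) \<open>0 < \<eta>\<close>] by blast
  obtain a n where "p = (\<lambda>t. \<Sum>i\<le>n. a i * t ^ i)"
    using real_polynomial_function_imp_sum[OF p(1)] by blast
  with p(2) show ?case
    by (intro exI[of _ a] exI[of _ n]) (auto intro!: less_imp_le)
next
  case (Suc q)
  define D where
    "D c n k t = (\<Sum>m\<le>n. c m * real (m choose k) * t ^ (m - k))" for c n k and t :: real
  obtain c n where c: "\<And>k t. k \<le> q \<Longrightarrow> t \<in> {0..1} \<Longrightarrow>
      \<bar>H (Suc k) t - fact k * D c n k t\<bar> \<le> \<eta>"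
    using Suc.IH[of "\<lambda>k. H (Suc k)", OF Suc.prems(1) Suc.prems(2)] unfolding D_def by fastforce
  \<comment> \<open>Coefficients of the antiderivative of \<open>D c n 0\<close>; the constant term
    \<open>H 0 0\<close> makes the error vanish at 0, which starts the mean value estimate
    below.\<close>
  define b where "b = (\<lambda>m. case m of 0 \<Rightarrow> H 0 0 | Suc i \<Rightarrow> c i / real (Suc i))"
  have b_deriv: "fact (Suc k) * D b (Suc n) (Suc k) t = fact k * D c n k t" for k t
  proof -
    have "fact (Suc k) * (c m / real (Suc m)) * real (Suc m choose Suc k) =
        fact k * c m * real (m choose k)" for m
    proof -
      have "real (Suc k) * real (Suc m choose Suc k) = real (Suc m) * real (m choose k)"
        using Suc_times_binomial[of k m] by (metis of_nat_mult)
      then show ?thesis by (simp add: field_simps del: of_nat_Suc binomial_Suc_Suc)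
    qed
    then have term_eq: "fact (Suc k) * (b (Suc m) * real (Suc m choose Suc k) * t ^ (Suc m - Suc k)) =
        fact k * (c m * real (m choose k) * t ^ (m - k))" for m
      by (simp only: b_def nat.case diff_Suc_Suc flip: mult.assoc)
    show ?thesis
      unfolding D_def sum_distrib_left unfolding sum.atMost_Suc_shift term_eq by simp
  qed
  have b0: "D b (Suc n) 0 t = H 0 0 + (\<Sum>m\<le>n. c m / real (Suc m) * t ^ Suc m)" for t
    unfolding D_def by (subst sum.atMost_Suc_shift) (simp add: b_def)
  have dD: "(D b (Suc n) 0 has_real_derivative D c n 0 t) (at t within {0..1})" for t
  proof -
    have "((\<lambda>t. c m / real (Suc m) * t ^ Suc m) has_real_derivative c m * t ^ m) (at t within {0..1})"
      for m
      using DERIV_cmult[OF DERIV_pow[of "Suc m"], of "c m / real (Suc m)"]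
      by (simp del: of_nat_Suc power_Suc)
    then have "((\<lambda>t. \<Sum>m\<le>n. c m / real (Suc m) * t ^ Suc m) has_real_derivative (\<Sum>m\<le>n. c m * t ^ m))
        (at t within {0..1})"
      by (rule DERIV_sum)
    then have "((\<lambda>t. H 0 0 + (\<Sum>m\<le>n. c m / real (Suc m) * t ^ Suc m)) has_real_derivative
        0 + (\<Sum>m\<le>n. c m * t ^ m)) (at t within {0..1})"
      by (rule DERIV_add[OF DERIV_const])
    then show ?thesis unfolding b0 by (simp add: D_def)
  qed
  have base: "\<bar>H 0 t - D b (Suc n) 0 t\<bar> \<le> \<eta>" if t: "t \<in> {0..1}" for t
  proof -
    let ?E = "\<lambda>t. H 0 t - D b (Suc n) 0 t"
    have "norm (?E t - ?E 0) \<le> \<eta> * norm (t - 0)"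
    proof (rule field_differentiable_bound[where S = "{0..1}" and f' = "\<lambda>t. H (Suc 0) t - D c n 0 t"])
      show "(?E has_field_derivative H (Suc 0) x - D c n 0 x) (at x within {0..1})"
        if "x \<in> {0..1}" for x
        using Suc.prems(1)[of 0 x] that dD[of x] by (intro DERIV_diff) auto
      show "norm (H (Suc 0) x - D c n 0 x) \<le> \<eta>" if "x \<in> {0..1}" for x
        using c[of 0 x] that by simp
    qed (use t in auto)
    moreover have "?E 0 = 0" by (simp add: b0)
    moreover have "\<eta> * norm (t - 0) \<le> \<eta>" using t \<open>0 < \<eta>\<close> by (simp add: mult_left_le)
    ultimately show ?thesis by simp
  qed
  have "\<bar>H k t - fact k * D b (Suc n) k t\<bar> \<le> \<eta>" if "k \<le> Suc q" "t \<in> {0..1}" for k t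
    using that base c[of "k - 1" t] by (cases k) (auto simp: b_deriv simp del: fact_Suc)
  then show ?case unfolding D_def by blast
qed

text \<open>The measures \<open>\<nu> k\<close> act as a dual feasible point. By
  \<open>moments\<close>, adding up the integrals of the scaled derivatives of a polynomial returns
  its value at 1. As the measures are finite and live on the unit interval, uniform approximation of
  all derivatives up to order \<open>\<zeta>\<close> carries this over to \<open>g\<close>, up to an
  error \<open>e\<close>.\<close>

lemma weak_duality:
  fixes \<nu> :: "nat \<Rightarrow> real measure" and \<phi> :: "nat \<Rightarrow> real \<Rightarrow> real"
  assumes fin: "\<And>k. finite_measure (\<nu> k)" and sets: "\<And>k. sets (\<nu> k) = sets borel"
    and supp: "\<And>k. AE t in \<nu> k. t \<in> {0..1}"
    and moments: "\<And>m. (\<Sum>k\<le>\<zeta>. real (m choose k) * (\<integral>t. t ^ (m - k) \<partial>\<nu> k)) = 1"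
    and int: "\<And>k. k \<le> \<zeta> \<Longrightarrow> integrable (\<nu> k) (\<phi> k)"
    and g: "g \<in> C01 \<zeta>"
    and le: "\<And>k t. k \<le> \<zeta> \<Longrightarrow> t \<in> {0..1} \<Longrightarrow> \<phi> k t \<le> 1 / fact k * nth_deriv01 k g t"
  shows "(\<Sum>k\<le>\<zeta>. \<integral>t. \<phi> k t \<partial>\<nu> k) \<le> g 1"
proof (rule field_le_epsilon)
  fix e :: real assume e: "0 < e"
  \<comment> \<open>The sum pays for the uniform error integrated against the measures, the extra 1
    for the error in \<open>g 1\<close>.\<close>
  define A where "A = 1 + (\<Sum>k\<le>\<zeta>. measure (\<nu> k) (space (\<nu> k)))"
  have A: "1 \<le> A" unfolding A_def by (simp add: sum_nonneg)
  define \<eta> where "\<eta> = e / A"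
  have \<eta>: "0 < \<eta>" "\<eta> * A = e" using e A by (auto simp: \<eta>_def)
  obtain c n where c: "\<And>k t. k \<le> \<zeta> \<Longrightarrow> t \<in> {0..1} \<Longrightarrow>
      \<bar>nth_deriv01 k g t - fact k * (\<Sum>m\<le>n. c m * real (m choose k) * t ^ (m - k))\<bar> \<le> \<eta>"
    using polynomial_approximates_derivatives[of \<zeta> "\<lambda>k. nth_deriv01 k g", OF C01_has_real_derivative[OF g] _ \<eta>(1)]
      g unfolding C01_def by fastforce
  let ?p = "\<lambda>k t. \<Sum>m\<le>n. c m * real (m choose k) * t ^ (m - k)"
  have int_pow: "integrable (\<nu> k) (\<lambda>t. t ^ j)" for k j
  proof -
    interpret finite_measure "\<nu> k" by (rule fin)
    show ?thesis
    proof (rule integrable_const_bound[where B = 1])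
      show "AE t in \<nu> k. norm (t ^ j) \<le> 1"
        using supp[of k] by eventually_elim (auto simp: power_abs intro!: power_le_one)
      show "(\<lambda>t. t ^ j) \<in> borel_measurable (\<nu> k)"
        unfolding measurable_cong_sets[OF sets refl] by measurable
    qed
  qed
  have step: "(\<integral>t. \<phi> k t \<partial>\<nu> k) \<le>
      (\<Sum>m\<le>n. c m * real (m choose k) * (\<integral>t. t ^ (m - k) \<partial>\<nu> k)) + \<eta> * measure (\<nu> k) (space (\<nu> k))"
    if k: "k \<le> \<zeta>" for k
  proof -
    interpret finite_measure "\<nu> k" by (rule fin)
    have "\<phi> k t \<le> ?p k t + \<eta>" if t: "t \<in> {0..1}" for t
    proof -
      have "nth_deriv01 k g t \<le> fact k * ?p k t + \<eta>" using c[OF k t] by linarith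
      \<comment> \<open>Since \<open>fact k\<close> is at least 1, the error may be multiplied by it
        and so survives the division by \<open>fact k\<close>.\<close>
      also have "\<dots> \<le> fact k * (?p k t + \<eta>)"
        using \<eta>(1) by (simp add: algebra_simps mult_le_cancel_left1)
      finally have "1 / fact k * nth_deriv01 k g t \<le> ?p k t + \<eta>"
        by (simp add: field_simps)
      with le[OF k t] show ?thesis by linarith
    qed
    then have "(\<integral>t. \<phi> k t \<partial>\<nu> k) \<le> (\<integral>t. ?p k t + \<eta> \<partial>\<nu> k)"
      using supp[of k] int[OF k] int_pow by (intro integral_mono_AE) auto
    then show ?thesis using int_pow by (simp add: mult.commute[of \<eta>])
  qed
  have "(\<Sum>k\<le>\<zeta>. \<integral>t. \<phi> k t \<partial>\<nu> k) \<le>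
      (\<Sum>k\<le>\<zeta>. (\<Sum>m\<le>n. c m * real (m choose k) * (\<integral>t. t ^ (m - k) \<partial>\<nu> k)) +
         \<eta> * measure (\<nu> k) (space (\<nu> k)))"
    by (intro sum_mono step) simp
  also have "\<dots> = (\<Sum>m\<le>n. c m * (\<Sum>k\<le>\<zeta>. real (m choose k) * (\<integral>t. t ^ (m - k) \<partial>\<nu> k))) + \<eta> * (A - 1)"
    by (simp add: sum.distrib sum_distrib_left mult.assoc A_def sum.swap[of _ "{..n}"])
  \<comment> \<open>By \<open>moments\<close> every inner sum is 1; the sum of the coefficients that
    remains is the value of the polynomial at 1.\<close>
  also have "\<dots> = (\<Sum>m\<le>n. c m) + \<eta> * A - \<eta>"
    by (simp add: moments algebra_simps)
  also have "\<dots> \<le> g 1 + e"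
    using c[of 0 1] by (simp add: \<eta>(2))
  finally show "(\<Sum>k\<le>\<zeta>. \<integral>t. \<phi> k t \<partial>\<nu> k) \<le> g 1 + e" .
qed

section \<open>Scenario programs under change and relabelling of scenarios\<close>

lemma sp_optimal_iff:
  "sp_optimal X J f I w x \<longleftrightarrow> x \<in> X \<and> (\<forall>i\<in>I. f x (w i) \<le> 0) \<and>
    (\<forall>y\<in>X. (\<forall>i\<in>I. f y (w i) \<le> 0) \<longrightarrow> J x \<le> J y)"
  by (auto simp: sp_optimal_def sp_feasible_def is_arg_min_def not_less)

lemma sp_optimal_cong:
  "(\<And>i. i \<in> I \<Longrightarrow> w i = w' i) \<Longrightarrow> sp_optimal X J f I w = sp_optimal X J f I w'"
  by (simp add: fun_eq_iff sp_optimal_iff)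

lemma sp_solution_cong:
  "(\<And>i. i \<in> I \<Longrightarrow> w i = w' i) \<Longrightarrow> sp_solution X J f I w = sp_solution X J f I w'"
  unfolding sp_solution_def by (subst sp_optimal_cong[of I w w']) auto

lemma support_constraints_cong:
  assumes "\<And>i. i \<in> I \<Longrightarrow> w i = w' i"
  shows "support_constraints X J f I w = support_constraints X J f I w'"
proof -
  have "sp_solution X J f K w = sp_solution X J f K w'" if "K \<subseteq> I" for K
    using assms that by (intro sp_solution_cong) auto
  then show ?thesis by (auto simp: support_constraints_def)
qed

lemma sp_optimal_image: "sp_optimal X J f (\<pi> ` I) w = sp_optimal X J f I (w \<circ> \<pi>)"
  by (simp add: fun_eq_iff sp_optimal_iff)

lemma sp_solution_image: "sp_solution X J f (\<pi> ` I) w = sp_solution X J f I (w \<circ> \<pi>)"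
  by (simp add: sp_solution_def sp_optimal_image)

text \<open>Injectivity ensures that deleting \<open>\<pi> i\<close> from the image removes the
  constraint of the index \<open>i\<close> alone.\<close>

lemma support_constraints_image:
  assumes "inj_on \<pi> I"
  shows "support_constraints X J f (\<pi> ` I) w = \<pi> ` support_constraints X J f I (w \<circ> \<pi>)"
proof -
  have "\<pi> ` I - {\<pi> i} = \<pi> ` (I - {i})" if "i \<in> I" for i
    using inj_on_image_set_diff[OF assms, of I "{i}"] that by auto
  then show ?thesis
    by (auto simp: support_constraints_def sp_solution_image)
qed

lemma support_constraints_subset: "support_constraints X J f I w \<subseteq> I"
  by (auto simp: support_constraints_def)

section \<open>Counting hits among independent samples\<close>

lemma sum_Pow_by_card:
  fixes h :: "nat \<Rightarrow> 'b :: semiring_1"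
  assumes "finite A"
  shows "(\<Sum>T\<in>Pow A. h (card T)) = (\<Sum>l\<le>card A. of_nat (card A choose l) * h l)"
proof -
  have "(\<Sum>T\<in>Pow A. h (card T)) = (\<Sum>l\<le>card A. \<Sum>T\<in>{T \<in> Pow A. card T = l}. h (card T))"
    using assms by (intro sum.group[symmetric]) (auto intro: card_mono)
  also have "\<dots> = (\<Sum>l\<le>card A. of_nat (card A choose l) * h l)"
    using n_subsets[OF assms] by (intro sum.cong) (auto simp: Pow_def)
  finally show ?thesis .
qed

text \<open>The number of hits is binomially distributed. The space splits into the boxes
  \<open>B T\<close>, on which exactly the coordinates in \<open>T\<close> hit \<open>A\<close>; the
  probability of a box depends on the cardinality of \<open>T\<close> only.\<close>

lemma (in prob_space) integral_PiM_card_hits: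
  fixes \<Psi> :: "nat \<Rightarrow> real"
  assumes "finite K" and A: "A \<in> events"
  shows "(\<integral>y. \<Psi> (card {j \<in> K. y j \<in> A}) \<partial>PiM K (\<lambda>_. M)) =
    (\<Sum>l\<le>card K. real (card K choose l) * (prob A ^ l * (1 - prob A) ^ (card K - l) * \<Psi> l))"
proof -
  interpret PK: prob_space "PiM K (\<lambda>_. M)" by (intro prob_space_PiM prob_space_axioms)
  interpret product_sigma_finite "\<lambda>_. M" by standard
  define B where "B T = (\<Pi>\<^sub>E j\<in>K. if j \<in> T then A else space M - A)" for T
  have B_sets: "B T \<in> sets (PiM K (\<lambda>_. M))" for T
    unfolding B_def using A \<open>finite K\<close> by (intro sets_PiM_I_finite) auto
  have B_iff: "y \<in> B T \<longleftrightarrow> {j \<in> K. y j \<in> A} = T"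
    if "y \<in> space (PiM K (\<lambda>_. M))" "T \<subseteq> K" for y T
  proof -
    have "y \<in> B T \<longleftrightarrow> (\<forall>j\<in>K. y j \<in> (if j \<in> T then A else space M - A))"
      using that(1) by (simp add: B_def space_PiM PiE_iff)
    also have "\<dots> \<longleftrightarrow> (\<forall>j\<in>K. y j \<in> A \<longleftrightarrow> j \<in> T)"
      using that(1) by (intro ball_cong) (auto simp: space_PiM PiE_iff)
    finally show ?thesis using that(2) by blast
  qed
  have B_prob: "measure (PiM K (\<lambda>_. M)) (B T) = prob A ^ card T * (1 - prob A) ^ (card K - card T)"
    if T: "T \<subseteq> K" for T
  proof -
    have "measure (PiM K (\<lambda>_. M)) (B T) = (\<Prod>j\<in>K. if j \<in> T then prob A else prob (space M - A))"
    proof -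
      have "emeasure (PiM K (\<lambda>_. M)) (B T) = (\<Prod>j\<in>K. emeasure M (if j \<in> T then A else space M - A))"
        unfolding B_def using A \<open>finite K\<close> by (intro emeasure_PiM) auto
      also have "\<dots> = ennreal (\<Prod>j\<in>K. if j \<in> T then prob A else prob (space M - A))"
        by (subst prod_ennreal[symmetric]) (auto intro!: prod.cong simp: emeasure_eq_measure)
      finally show ?thesis by (simp add: measure_def prod_nonneg)
    qed
    also have "\<dots> = prob A ^ card (K \<inter> T) * (1 - prob A) ^ card (K - T)"
      using \<open>finite K\<close> prob_compl[OF A] by (simp add: prod.If_cases Diff_eq Collect_mem_eq)
    also have "K \<inter> T = T" using T by auto
    finally show ?thesis
      using T \<open>finite K\<close> by (simp add: card_Diff_subset finite_subset)
  qed
  have "(\<integral>y. \<Psi> (card {j \<in> K. y j \<in> A}) \<partial>PiM K (\<lambda>_. M)) =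
      (\<integral>y. (\<Sum>T\<in>Pow K. indicator (B T) y * \<Psi> (card T)) \<partial>PiM K (\<lambda>_. M))"
  proof (rule Bochner_Integration.integral_cong)
    fix y assume y: "y \<in> space (PiM K (\<lambda>_. M))"
    have "(\<Sum>T\<in>Pow K. indicator (B T) y * \<Psi> (card T)) =
        (\<Sum>T\<in>Pow K. if {j \<in> K. y j \<in> A} = T then \<Psi> (card T) else 0)"
      using B_iff[OF y] by (intro sum.cong) (auto simp: indicator_def)
    then show "\<Psi> (card {j \<in> K. y j \<in> A}) = (\<Sum>T\<in>Pow K. indicator (B T) y * \<Psi> (card T))"
      using \<open>finite K\<close> by (simp add: sum.delta)
  qed simp
  also have "\<dots> = (\<Sum>T\<in>Pow K. measure (PiM K (\<lambda>_. M)) (B T) * \<Psi> (card T))"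
    using B_sets by (simp add: PK.emeasure_eq_measure)
  also have "\<dots> = (\<Sum>T\<in>Pow K. prob A ^ card T * (1 - prob A) ^ (card K - card T) * \<Psi> (card T))"
    using B_prob by (intro sum.cong) auto
  also have "\<dots> = (\<Sum>l\<le>card K. real (card K choose l) * (prob A ^ l * (1 - prob A) ^ (card K - l) * \<Psi> l))"
    by (rule sum_Pow_by_card[OF \<open>finite K\<close>])
  finally show ?thesis .
qed

section \<open>Optimal solutions and support sets\<close>

text \<open>Measurability enters as a joint statement about a sample and a fresh scenario: its
  sections yield the violation probability, and its preimages under reindexing yield the support
  sets and the violation counts.\<close>

locale scenario_program = prob_space P for P :: "'d measure" +
  fixes X :: "'a set" and J :: "'a \<Rightarrow> real" and f :: "'a \<Rightarrow> 'd \<Rightarrow> real" and \<zeta> :: nat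
  assumes feasibility_uniqueness:
      "\<And>m \<omega>. \<omega> \<in> space (PiM {..<m} (\<lambda>_. P)) \<Longrightarrow> \<exists>!x. sp_optimal X J f {..<m} \<omega> x"
    and measurable_solution_violation:
      "\<And>m. {(\<omega>, \<delta>) \<in> space (PiM {..<m} (\<lambda>_. P) \<Otimes>\<^sub>M P). f (sp_solution X J f {..<m} \<omega>) \<delta> > 0}
             \<in> sets (PiM {..<m} (\<lambda>_. P) \<Otimes>\<^sub>M P)"
    and non_degeneracy:
      "\<And>m. AE \<omega> in PiM {..<m} (\<lambda>_. P).
         sp_solution X J f {..<m} \<omega> =
         sp_solution X J f (support_constraints X J f {..<m} \<omega>) \<omega>"
    and zeta_bound:
      "\<And>m. AE \<omega> in PiM {..<m} (\<lambda>_. P). card (support_constraints X J f {..<m} \<omega>) \<le> \<zeta>"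
begin

abbreviation sol :: "nat set \<Rightarrow> (nat \<Rightarrow> 'd) \<Rightarrow> 'a" where
  "sol I w \<equiv> sp_solution X J f I w"

abbreviation supp :: "nat set \<Rightarrow> (nat \<Rightarrow> 'd) \<Rightarrow> nat set" where
  "supp I w \<equiv> support_constraints X J f I w"

abbreviation Samples :: "nat \<Rightarrow> (nat \<Rightarrow> 'd) measure" where
  "Samples m \<equiv> PiM {..<m} (\<lambda>_. P)"

text \<open>The assumption speaks of initial segments of indices; an enumeration of \<open>I\<close>
  transports it to every finite index set.\<close>

lemma ex1_optimal:
  assumes "finite I" and w: "w \<in> I \<rightarrow> space P"
  shows "\<exists>!x. sp_optimal X J f I w x"
proof -
  obtain \<pi> where \<pi>: "bij_betw \<pi> {..<card I} I"
    using ex_bij_betw_nat_finite[OF \<open>finite I\<close>] by (auto simp: lessThan_atLeast0)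
  have "restrict (w \<circ> \<pi>) {..<card I} \<in> space (Samples (card I))"
    using w bij_betwE[OF \<pi>] by (auto simp: space_PiM)
  from feasibility_uniqueness[OF this]
  have "\<exists>!x. sp_optimal X J f {..<card I} (w \<circ> \<pi>) x"
    by (subst (asm) sp_optimal_cong[where w' = "w \<circ> \<pi>"]) auto
  then show ?thesis
    using sp_optimal_image[of X J f \<pi> "{..<card I}" w] bij_betw_imp_surj_on[OF \<pi>] by simp
qed

lemma sol_optimal: "finite I \<Longrightarrow> w \<in> I \<rightarrow> space P \<Longrightarrow> sp_optimal X J f I w (sol I w)"
  unfolding sp_solution_def by (rule theI', rule ex1_optimal)

lemma sol_eqI:
  "finite I \<Longrightarrow> w \<in> I \<rightarrow> space P \<Longrightarrow> sp_optimal X J f I w x \<Longrightarrow> sol I w = x"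
  using ex1_optimal sol_optimal by blast

lemma sol_satisfies:
  "finite I \<Longrightarrow> w \<in> I \<rightarrow> space P \<Longrightarrow> i \<in> I \<Longrightarrow> f (sol I w) (w i) \<le> 0"
  using sol_optimal by (auto simp: sp_optimal_iff)

text \<open>A minimiser under fewer constraints that also meets the remaining ones minimises over
  the smaller feasible set too; uniqueness does the rest.\<close>

lemma sol_eq_if_satisfies:
  assumes "I \<subseteq> K" "finite K" "w \<in> K \<rightarrow> space P"
    and "\<And>i. i \<in> K - I \<Longrightarrow> f (sol I w) (w i) \<le> 0"
  shows "sol K w = sol I w"
proof (rule sol_eqI)
  have "finite I" "w \<in> I \<rightarrow> space P" using assms(1-3) finite_subset by auto
  note opt = sol_optimal[OF this] and sat = sol_satisfies[OF this]
  have "f (sol I w) (w i) \<le> 0" if "i \<in> K" for i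
    using sat assms(4) that by (cases "i \<in> I") auto
  then show "sp_optimal X J f K w (sol I w)"
    using opt \<open>I \<subseteq> K\<close> unfolding sp_optimal_iff by blast
qed (use assms in auto)

text \<open>The common solution of the two outer programs is feasible for \<open>K\<close>, hence
  for \<open>L\<close>, and it is optimal already under the constraints in \<open>I\<close>.\<close>

lemma sol_eq_between:
  assumes "I \<subseteq> L" "L \<subseteq> K" "finite K" "w \<in> K \<rightarrow> space P" "sol K w = sol I w"
  shows "sol L w = sol I w"
  using assms sol_satisfies[of K w] by (intro sol_eq_if_satisfies) (auto intro: finite_subset)

text \<open>This replaces a comparison of two solutions by a violation event, whose measurability is
  accessible.\<close>

lemma supp_iff:
  assumes "finite I" "w \<in> I \<rightarrow> space P" "i \<in> I"
  shows "i \<in> supp I w \<longleftrightarrow> f (sol (I - {i}) w) (w i) > 0"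
proof -
  have "sol I w = sol (I - {i}) w" if "f (sol (I - {i}) w) (w i) \<le> 0"
    using assms that by (intro sol_eq_if_satisfies) auto
  moreover have "f (sol (I - {i}) w) (w i) \<le> 0" if "sol (I - {i}) w = sol I w"
    using sol_satisfies[OF assms] that by simp
  ultimately show ?thesis
    using assms by (fastforce simp: support_constraints_def not_less[symmetric])
qed

text \<open>The right-hand side separates the scenarios: full support depends on those in
  \<open>S\<close> only, and each other scenario enters through one constraint evaluated at
  \<open>sol S w\<close>. This is what makes the event computable by independence. Both directions
  compare programs by \<open>sol_eq_between\<close>, anchored at \<open>nondeg\<close>.\<close>

lemma supp_eq_iff:
  assumes "finite I" "w \<in> I \<rightarrow> space P" "S \<subseteq> I" and nondeg: "sol I w = sol (supp I w) w"
  shows "supp I w = S \<longleftrightarrow> supp S w = S \<and> (\<forall>i\<in>I - S. f (sol S w) (w i) \<le> 0)"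
proof
  assume S: "supp I w = S"
  have "i \<in> supp (supp I w) w" if "i \<in> supp I w" for i
  proof (rule ccontr)
    assume "i \<notin> supp (supp I w) w"
    then have "sol (supp I w - {i}) w = sol (supp I w) w"
      using that by (simp add: support_constraints_def)
    \<comment> \<open>By \<open>nondeg\<close> the programs on \<open>supp I w - {i}\<close> and on
      \<open>I\<close> now share their solution, and \<open>I - {i}\<close> lies between
      them.\<close>
    then have "sol (I - {i}) w = sol I w"
      using nondeg support_constraints_subset[of X J f I w]
      by (subst sol_eq_between[of "supp I w - {i}" _ I, OF _ _ assms(1,2)]) auto
    then show False using that by (simp add: support_constraints_def)
  qed
  moreover have "f (sol (supp I w) w) (w i) \<le> 0" if "i \<in> I" for i
    using sol_satisfies[OF assms(1,2) that] nondeg by simp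
  ultimately show "supp S w = S \<and> (\<forall>i\<in>I - S. f (sol S w) (w i) \<le> 0)"
    using support_constraints_subset[of X J f S w] S by blast
next
  assume "supp S w = S \<and> (\<forall>i\<in>I - S. f (sol S w) (w i) \<le> 0)"
  then have S: "supp S w = S" and sat: "\<forall>i\<in>I - S. f (sol S w) (w i) \<le> 0" by auto
  have eq: "sol I w = sol S w"
    using assms(1-3) sat by (intro sol_eq_if_satisfies) auto
  have sub: "supp I w \<subseteq> S"
  proof
    fix i assume i: "i \<in> supp I w"
    show "i \<in> S"
    proof (rule ccontr)
      assume "i \<notin> S"
      then have "sol (I - {i}) w = sol S w"
        using assms(3) by (intro sol_eq_between[OF _ _ assms(1,2) eq]) auto
      with i eq show False by (simp add: support_constraints_def)
    qed
  qed
  moreover have "i \<in> supp I w" if i: "i \<in> S" for i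
  proof (rule ccontr)
    assume ni: "i \<notin> supp I w"
    \<comment> \<open>\<open>S - {i}\<close> still contains \<open>supp I w\<close>, so deleting
      \<open>i\<close> leaves the solution of the program on \<open>S\<close> unchanged, against
      full support.\<close>
    have "sol (S - {i}) w = sol (supp I w) w"
      using sub ni by (intro sol_eq_between[OF _ _ assms(1,2) nondeg]) (use assms(3) in auto)
    also have "\<dots> = sol S w" using nondeg eq by simp
    finally have "i \<notin> supp S w" by (simp add: support_constraints_def)
    with S i show False by simp
  qed
  ultimately show "supp I w = S" by blast
qed

section \<open>Satisfaction levels, violation counts and their measurability\<close>

definition level :: "nat \<Rightarrow> (nat \<Rightarrow> 'd) \<Rightarrow> real" where
  "level m \<omega> = 1 - violation_prob P f (sol {..<m} \<omega>)"

text \<open>The tested scenarios are the \<open>n\<close> coordinates following the first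
  \<open>k\<close> of one sample. They serve both as design scenarios outside the support set and as
  validation scenarios.\<close>

definition violations :: "nat \<Rightarrow> nat \<Rightarrow> (nat \<Rightarrow> 'd) \<Rightarrow> nat" where
  "violations k n \<omega> = card {j \<in> {k..<k + n}. f (sol {..<k} \<omega>) (\<omega> j) > 0}"

text \<open>The law of \<open>level k\<close> restricted to the event that all \<open>k\<close> constraints are of support, hence in
  general a sub-probability measure.\<close>

definition \<nu> :: "nat \<Rightarrow> real measure" where
  "\<nu> k = distr (density (Samples k) (\<lambda>\<omega>. ennreal (if supp {..<k} \<omega> = {..<k} then 1 else 0))) borel (level k)"

lemma prob_space_Samples: "prob_space (Samples m)"
  by (intro prob_space_PiM prob_space_axioms)

lemma Samples_space: "\<omega> \<in> space (Samples m) \<Longrightarrow> I \<subseteq> {..<m} \<Longrightarrow> \<omega> \<in> I \<rightarrow> space P"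
  by (auto simp: space_PiM)

lemma level_in_unit: "level m \<omega> \<in> {0..1}"
  by (simp add: level_def violation_prob_def)

lemma level_cong: "(\<And>i. i < m \<Longrightarrow> \<omega> i = \<omega>' i) \<Longrightarrow> level m \<omega> = level m \<omega>'"
  unfolding level_def by (subst sp_solution_cong[of "{..<m}" \<omega> \<omega>']) auto

lemma violation_set_section:
  assumes "\<omega> \<in> space (Samples m)"
  shows "violation_set P f (sol {..<m} \<omega>) =
    Pair \<omega> -` {(\<omega>, \<delta>) \<in> space (Samples m \<Otimes>\<^sub>M P). f (sol {..<m} \<omega>) \<delta> > 0}"
  using assms by (auto simp: violation_set_def space_pair_measure)

lemma violation_set_measurable:
  "\<omega> \<in> space (Samples m) \<Longrightarrow> violation_set P f (sol {..<m} \<omega>) \<in> events"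
  unfolding violation_set_section
  by (rule sets_Pair1[OF measurable_solution_violation])

lemma level_measurable [measurable]: "level m \<in> borel_measurable (Samples m)"
proof -
  have "(\<lambda>\<omega>. 1 - measure P (Pair \<omega> -` {(\<omega>, \<delta>) \<in> space (Samples m \<Otimes>\<^sub>M P).
      f (sol {..<m} \<omega>) \<delta> > 0})) \<in> borel_measurable (Samples m)"
    using measurable_emeasure_Pair[OF measurable_solution_violation[of m]]
    unfolding measure_def by measurable
  then show ?thesis
    by (rule measurable_cong[THEN iffD1, rotated])
      (simp add: level_def violation_prob_def violation_set_section)
qed

text \<open>Enumerating \<open>I\<close> gives a measurable map into the product of
  \<open>Samples k\<close> and \<open>P\<close>; the event is the preimage of the set in
  \<open>measurable_solution_violation\<close>.\<close>

lemma violates_measurable: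
  assumes "I \<subseteq> {..<m}" "i < m"
  shows "Measurable.pred (Samples m) (\<lambda>\<omega>. f (sol I \<omega>) (\<omega> i) > 0)"
proof -
  define k where "k = card I"
  obtain \<pi> where "bij_betw \<pi> {..<k} I"
    using ex_bij_betw_nat_finite[of I] assms(1) finite_subset
    by (auto simp: lessThan_atLeast0 k_def)
  then have I: "I = \<pi> ` {..<k}" by (simp add: bij_betw_imp_surj_on)
  have sol_I: "sol I \<omega> = sol {..<k} (\<lambda>n\<in>{..<k}. \<omega> (\<pi> n))" for \<omega>
    unfolding I sp_solution_image by (rule sp_solution_cong) simp
  let ?g = "\<lambda>\<omega>. (\<lambda>n\<in>{..<k}. \<omega> (\<pi> n), \<omega> i)"
  have g: "?g \<in> Samples m \<rightarrow>\<^sub>M Samples k \<Otimes>\<^sub>M P"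
    using assms I by (intro measurable_Pair measurable_restrict measurable_component_singleton) auto
  have "{\<omega> \<in> space (Samples m). f (sol I \<omega>) (\<omega> i) > 0} =
      ?g -` {(\<omega>, \<delta>) \<in> space (Samples k \<Otimes>\<^sub>M P). f (sol {..<k} \<omega>) \<delta> > 0} \<inter> space (Samples m)"
    using measurable_space[OF g] unfolding sol_I by blast
  then show ?thesis
    using measurable_sets[OF g measurable_solution_violation[of k]] by (simp add: pred_def)
qed

lemma supp_pred_measurable [measurable]:
  "Measurable.pred (Samples m) (\<lambda>\<omega>. i \<in> supp {..<m} \<omega>)"
proof (cases "i < m")
  case True
  then show ?thesis
    using violates_measurable[of "{..<m} - {i}" m i]
    by (subst measurable_cong[where g = "\<lambda>\<omega>. f (sol ({..<m} - {i}) \<omega>) (\<omega> i) > 0"])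
      (use supp_iff[OF finite_lessThan Samples_space] True in auto)
qed (simp add: support_constraints_def)

lemma card_supp_measurable [measurable]:
  "(\<lambda>\<omega>. card (supp {..<m} \<omega>)) \<in> Samples m \<rightarrow>\<^sub>M count_space UNIV"
  by (intro measurable_card) simp

lemma supp_eq_measurable [measurable]:
  assumes "S \<subseteq> {..<m}"
  shows "Measurable.pred (Samples m) (\<lambda>\<omega>. supp {..<m} \<omega> = S)"
proof -
  have "supp {..<m} \<omega> = S \<longleftrightarrow> (\<forall>i. i \<in> supp {..<m} \<omega> \<longleftrightarrow> i \<in> S)" for \<omega> by auto
  then show ?thesis by simp
qed

lemma violations_measurable [measurable]:
  "violations k n \<in> Samples (k + n) \<rightarrow>\<^sub>M count_space UNIV"
proof -
  have "{\<omega> \<in> space (Samples (k + n)). j \<in> {j \<in> {k..<k + n}. f (sol {..<k} \<omega>) (\<omega> j) > 0}}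
      \<in> sets (Samples (k + n))" for j
  proof (cases "j \<in> {k..<k + n}")
    case True
    then have "Measurable.pred (Samples (k + n)) (\<lambda>\<omega>. f (sol {..<k} \<omega>) (\<omega> j) > 0)"
      by (intro violates_measurable) auto
    with True show ?thesis by (simp add: pred_def)
  next
    case False
    then have "{\<omega> \<in> space (Samples (k + n)). j \<in> {j \<in> {k..<k + n}. f (sol {..<k} \<omega>) (\<omega> j) > 0}} = {}"
      by blast
    then show ?thesis by (simp only: sets.empty_sets)
  qed
  then show ?thesis
    unfolding violations_def by (rule measurable_card)
qed

section \<open>Conditioning on the first scenarios, and exchangeability\<close>

text \<open>Fubini: with the first \<open>k\<close> scenarios fixed at \<open>x\<close>, the other
  \<open>n\<close> are independent and each violates the fixed solution with probability
  \<open>1 - level k x\<close>, so the count is binomial.\<close>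

lemma integral_violations:
  fixes \<Psi> :: "(nat \<Rightarrow> 'd) \<Rightarrow> nat \<Rightarrow> real"
  assumes \<Psi> [measurable]: "\<And>l. (\<lambda>x. \<Psi> x l) \<in> borel_measurable (Samples k)"
    and bound: "\<And>x l. \<bar>\<Psi> x l\<bar> \<le> C"
  shows "(\<integral>\<omega>. \<Psi> (restrict \<omega> {..<k}) (violations k n \<omega>) \<partial>Samples (k + n)) =
    (\<integral>x. (\<Sum>l\<le>n. real (n choose l) * ((1 - level k x) ^ l * level k x ^ (n - l) * \<Psi> x l)) \<partial>Samples k)"
proof -
  interpret product_sigma_finite "\<lambda>_. P" by standard
  interpret S: prob_space "Samples (k + n)" by (rule prob_space_Samples)
  let ?K = "{k..<k + n}"
  let ?F = "\<lambda>\<omega>. \<Psi> (restrict \<omega> {..<k}) (violations k n \<omega>)"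
  have un: "{..<k} \<union> ?K = {..<k + n}" and disj: "{..<k} \<inter> ?K = {}" by auto
  have [measurable]: "(\<lambda>\<omega>. restrict \<omega> {..<k}) \<in> Samples (k + n) \<rightarrow>\<^sub>M Samples k"
    by (intro measurable_restrict_subset) auto
  have "?F \<in> borel_measurable (Samples (k + n))"
    by (rule measurable_compose_countable[OF _ violations_measurable]) measurable
  then have "integrable (PiM ({..<k} \<union> ?K) (\<lambda>_. P)) ?F"
    unfolding un using bound by (intro S.integrable_const_bound[of _ C]) auto
  then have "(\<integral>\<omega>. ?F \<omega> \<partial>Samples (k + n)) =
      (\<integral>x. (\<integral>y. ?F (merge {..<k} ?K (x, y)) \<partial>PiM ?K (\<lambda>_. P)) \<partial>Samples k)"
    using product_integral_fold[of "{..<k}" ?K ?F] unfolding un by (simp only: disj finite_lessThan finite_atLeastLessThan)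
  also have "\<dots> = (\<integral>x. (\<Sum>l\<le>n. real (n choose l) *
      ((1 - level k x) ^ l * level k x ^ (n - l) * \<Psi> x l)) \<partial>Samples k)"
  proof (rule Bochner_Integration.integral_cong)
    fix x assume x: "x \<in> space (Samples k)"
    have "(\<integral>y. ?F (merge {..<k} ?K (x, y)) \<partial>PiM ?K (\<lambda>_. P)) =
        (\<integral>y. \<Psi> x (card {j \<in> ?K. y j \<in> violation_set P f (sol {..<k} x)}) \<partial>PiM ?K (\<lambda>_. P))"
    proof (rule Bochner_Integration.integral_cong)
      fix y assume y: "y \<in> space (PiM ?K (\<lambda>_. P))"
      have "restrict (merge {..<k} ?K (x, y)) {..<k} = x"
        using x by (auto simp: merge_def space_PiM PiE_iff extensional_def fun_eq_iff)
      moreover have "sol {..<k} (merge {..<k} ?K (x, y)) = sol {..<k} x"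
        by (rule sp_solution_cong) (simp add: merge_def)
      then have "violations k n (merge {..<k} ?K (x, y)) =
          card {j \<in> ?K. y j \<in> violation_set P f (sol {..<k} x)}"
        unfolding violations_def using y
        by (intro arg_cong[of _ _ card]) (auto simp: merge_def violation_set_def space_PiM PiE_iff)
      ultimately show "?F (merge {..<k} ?K (x, y)) =
          \<Psi> x (card {j \<in> ?K. y j \<in> violation_set P f (sol {..<k} x)})" by simp
    qed simp
    then show "(\<integral>y. ?F (merge {..<k} ?K (x, y)) \<partial>PiM ?K (\<lambda>_. P)) =
        (\<Sum>l\<le>n. real (n choose l) * ((1 - level k x) ^ l * level k x ^ (n - l) * \<Psi> x l))"
      using integral_PiM_card_hits[of ?K _ "\<Psi> x", OF _ violation_set_measurable[OF x]]
      by (simp add: level_def violation_prob_def)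
  qed simp
  finally show ?thesis .
qed

text \<open>Exchangeability of independent samples; it lets an arbitrary support set be moved to the
  first indices.\<close>

lemma Samples_permute:
  assumes \<pi>: "bij_betw \<pi> {..<m} {..<m}" and F: "F \<in> borel_measurable (Samples m)"
  shows "(\<integral>\<omega>. F (\<lambda>n\<in>{..<m}. \<omega> (\<pi> n)) \<partial>Samples m) = (\<integral>\<omega>. (F \<omega> :: real) \<partial>Samples m)"
proof -
  have "distr (Samples m) (Samples m) (\<lambda>\<omega>. \<lambda>n\<in>{..<m}. \<omega> (\<pi> n)) = Samples m"
    using bij_betwE[OF \<pi>] bij_betw_imp_inj_on[OF \<pi>]
    by (intro distr_PiM_reindex prob_space_axioms) auto
  moreover have "(\<lambda>\<omega>. \<lambda>n\<in>{..<m}. \<omega> (\<pi> n)) \<in> Samples m \<rightarrow>\<^sub>M Samples m"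
    using bij_betwE[OF \<pi>] by (intro measurable_restrict measurable_component_singleton) auto
  ultimately show ?thesis using integral_distr[OF _ F] by metis
qed

section \<open>The measures \<open>\<nu> k\<close> and integrals over support events\<close>

lemma full_supp_measurable [measurable]:
  "Measurable.pred (Samples k) (\<lambda>\<omega>. supp {..<k} \<omega> = {..<k})"
  by (rule supp_eq_measurable) simp

lemma finite_measure_\<nu>: "finite_measure (\<nu> k)"
proof -
  interpret S: prob_space "Samples k" by (rule prob_space_Samples)
  let ?d = "\<lambda>\<omega>. ennreal (if supp {..<k} \<omega> = {..<k} then 1 else 0)"
  have "(\<integral>\<^sup>+\<omega>. ?d \<omega> \<partial>Samples k) \<le> (\<integral>\<^sup>+\<omega>. 1 \<partial>Samples k)"
    by (intro nn_integral_mono) auto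
  also have "\<dots> = 1" by (simp add: S.emeasure_space_1)
  finally have "emeasure (density (Samples k) ?d) (space (density (Samples k) ?d)) \<le> 1"
    by (simp add: emeasure_density cong: nn_integral_cong)
  then have "emeasure (density (Samples k) ?d) (space (density (Samples k) ?d)) \<noteq> \<infinity>"
    by (metis ennreal_one_neq_top infinity_ennreal_def top_unique)
  then have "finite_measure (density (Samples k) ?d)" by (rule finite_measureI)
  then show ?thesis
    unfolding \<nu>_def by (rule finite_measure.finite_measure_distr) simp
qed

lemma sets_\<nu> [measurable_cong]: "sets (\<nu> k) = sets borel"
  by (simp add: \<nu>_def)

lemma AE_\<nu>: "AE t in \<nu> k. t \<in> {0..1}"
  unfolding \<nu>_def using level_in_unit by (subst AE_distr_iff) auto

lemma integral_\<nu>: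
  assumes [measurable]: "h \<in> borel_measurable borel"
  shows "(\<integral>t. h t \<partial>\<nu> k) =
    (\<integral>\<omega>. (if supp {..<k} \<omega> = {..<k} then h (level k \<omega>) else (0::real)) \<partial>Samples k)"
proof -
  have "(\<integral>t. h t \<partial>\<nu> k) = (\<integral>\<omega>. (if supp {..<k} \<omega> = {..<k} then 1 else 0) *\<^sub>R h (level k \<omega>) \<partial>Samples k)"
    unfolding \<nu>_def by (subst integral_distr, simp, simp, subst integral_density) auto
  also have "\<dots> = (\<integral>\<omega>. (if supp {..<k} \<omega> = {..<k} then h (level k \<omega>) else 0) \<partial>Samples k)"
    by (intro Bochner_Integration.integral_cong) auto
  finally show ?thesis .
qed

text \<open>A permutation moves \<open>S\<close> to the front. By \<open>supp_eq_iff\<close> the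
  event then says that the first \<open>k\<close> constraints are all of support and that none of
  the other \<open>m - k\<close> is violated; given the former scenarios, the latter has probability
  \<open>t ^ (m - k)\<close>. Almost surely both programs have the same solution, hence the same
  level.\<close>

lemma integral_supp_eq:
  fixes h :: "real \<Rightarrow> real"
  assumes S: "S \<subseteq> {..<m}" and h [measurable]: "h \<in> borel_measurable borel"
    and bound: "\<And>t. t \<in> {0..1} \<Longrightarrow> \<bar>h t\<bar> \<le> C"
  shows "(\<integral>\<omega>. (if supp {..<m} \<omega> = S then h (level m \<omega>) else 0) \<partial>Samples m) =
    (\<integral>t. h t * t ^ (m - card S) \<partial>\<nu> (card S))"
proof -
  define k where "k = card S"
  define n where "n = m - k"
  have "finite S" using S finite_subset by blast
  have "k \<le> m" using card_mono[OF _ S] by (simp add: k_def)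
  then have m: "m = k + n" by (simp add: n_def)
  have C: "0 \<le> C" using bound[of 0] by simp
  obtain \<pi>1 where \<pi>1: "bij_betw \<pi>1 {..<k} S"
    using ex_bij_betw_nat_finite[OF \<open>finite S\<close>] by (auto simp: lessThan_atLeast0 k_def)
  have "card {k..<m} = card ({..<m} - S)"
    using S \<open>finite S\<close> by (simp add: card_Diff_subset k_def)
  then obtain \<pi>2 where \<pi>2: "bij_betw \<pi>2 {k..<m} ({..<m} - S)"
    using finite_same_card_bij[of "{k..<m}" "{..<m} - S"] by auto
  define \<pi> where "\<pi> i = (if i < k then \<pi>1 i else \<pi>2 i)" for i
  have \<pi>S: "bij_betw \<pi> {..<k} S"
    using \<pi>1 by (rule bij_betw_cong[THEN iffD1, rotated]) (simp add: \<pi>_def)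
  have \<pi>R: "bij_betw \<pi> {k..<m} ({..<m} - S)"
    using \<pi>2 by (rule bij_betw_cong[THEN iffD1, rotated]) (simp add: \<pi>_def)
  have \<pi>: "bij_betw \<pi> {..<m} {..<m}"
  proof -
    have "{..<k} \<union> {k..<m} = {..<m}" "S \<union> ({..<m} - S) = {..<m}" using \<open>k \<le> m\<close> S by auto
    then show ?thesis using bij_betw_combine[OF \<pi>S \<pi>R] by simp
  qed
  \<comment> \<open>The condition \<open>l = 0\<close> encodes that no remaining scenario is
    violated; in the binomial sum it leaves only the term \<open>level k x ^ n\<close>.\<close>
  define \<Psi> where "\<Psi> x l = (if l = 0 \<and> supp {..<k} x = {..<k} then h (level k x) else 0)"
    for x and l :: nat
  have \<Psi>_meas [measurable]: "(\<lambda>x. \<Psi> x l) \<in> borel_measurable (Samples k)" for l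
    unfolding \<Psi>_def by measurable
  have \<Psi>_bound: "\<bar>\<Psi> x l\<bar> \<le> C" for x l
    unfolding \<Psi>_def using bound[OF level_in_unit] C by auto
  let ?F = "\<lambda>\<omega>. \<Psi> (restrict \<omega> {..<k}) (violations k n \<omega>)"
  have F: "?F \<in> borel_measurable (Samples m)"
  proof -
    have [measurable]: "(\<lambda>\<omega>. restrict \<omega> {..<k}) \<in> Samples m \<rightarrow>\<^sub>M Samples k"
      using \<open>k \<le> m\<close> by (intro measurable_restrict_subset) auto
    show ?thesis
      by (rule measurable_compose_countable[OF _ violations_measurable[of k n, folded m]]) measurable
  qed
  have "(\<integral>\<omega>. (if supp {..<m} \<omega> = S then h (level m \<omega>) else 0) \<partial>Samples m) =
      (\<integral>\<omega>. ?F (\<lambda>n\<in>{..<m}. \<omega> (\<pi> n)) \<partial>Samples m)"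
  proof (rule integral_cong_AE)
    show "(\<lambda>\<omega>. if supp {..<m} \<omega> = S then h (level m \<omega>) else 0) \<in> borel_measurable (Samples m)"
      using supp_eq_measurable[OF S] by measurable
    show "(\<lambda>\<omega>. ?F (\<lambda>n\<in>{..<m}. \<omega> (\<pi> n))) \<in> borel_measurable (Samples m)"
      using bij_betwE[OF \<pi>]
      by (intro measurable_compose[OF _ F] measurable_restrict measurable_component_singleton) auto
    show "AE \<omega> in Samples m. (if supp {..<m} \<omega> = S then h (level m \<omega>) else 0) =
        ?F (\<lambda>n\<in>{..<m}. \<omega> (\<pi> n))"
      using non_degeneracy AE_space
    proof eventually_elim
      case (elim \<omega>)
      let ?\<omega> = "\<lambda>n\<in>{..<m}. \<omega> (\<pi> n)"
      have S_img: "S = \<pi> ` {..<k}" using \<pi>S by (simp add: bij_betw_imp_surj_on)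
      have R_img: "{..<m} - S = \<pi> ` {k..<m}" using \<pi>R by (simp add: bij_betw_imp_surj_on)
      have sol_eq: "sol {..<k} ?\<omega> = sol S \<omega>"
        unfolding S_img sp_solution_image using \<open>k \<le> m\<close> by (intro sp_solution_cong) auto
      have supp_S: "supp S \<omega> = \<pi> ` supp {..<k} ?\<omega>"
      proof -
        have "supp {..<k} (\<omega> \<circ> \<pi>) = supp {..<k} ?\<omega>"
          using \<open>k \<le> m\<close> by (intro support_constraints_cong) auto
        then show ?thesis
          unfolding S_img using support_constraints_image[OF bij_betw_imp_inj_on[OF \<pi>S]] by metis
      qed
      have full: "supp S \<omega> = S \<longleftrightarrow> supp {..<k} ?\<omega> = {..<k}"
        using inj_on_image_eq_iff[OF bij_betw_imp_inj_on[OF \<pi>S] support_constraints_subset order_refl]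
          supp_S S_img by metis
      have "violations k n ?\<omega> = 0 \<longleftrightarrow> (\<forall>j\<in>{k..<m}. f (sol S \<omega>) (\<omega> (\<pi> j)) \<le> 0)"
        unfolding violations_def sol_eq m[symmetric]
        by (subst card_0_eq) (auto simp: not_less)
      also have "\<dots> \<longleftrightarrow> (\<forall>i\<in>{..<m} - S. f (sol S \<omega>) (\<omega> i) \<le> 0)"
        unfolding R_img by blast
      finally have none: "violations k n ?\<omega> = 0 \<longleftrightarrow> (\<forall>i\<in>{..<m} - S. f (sol S \<omega>) (\<omega> i) \<le> 0)" .
      have restr: "supp {..<k} (restrict ?\<omega> {..<k}) = supp {..<k} ?\<omega>"
        "level k (restrict ?\<omega> {..<k}) = level k ?\<omega>"
        by (rule support_constraints_cong level_cong; simp)+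
      have "supp {..<m} \<omega> = S \<longleftrightarrow> violations k n ?\<omega> = 0 \<and> supp {..<k} ?\<omega> = {..<k}"
        using supp_eq_iff[OF finite_lessThan Samples_space[OF elim(2) order_refl] S elim(1)]
          full none by blast
      moreover have "level m \<omega> = level k ?\<omega>" if "supp {..<m} \<omega> = S"
        using elim(1) sol_eq that by (simp add: level_def)
      ultimately show ?case unfolding \<Psi>_def restr by presburger
    qed
  qed
  also have "\<dots> = (\<integral>\<omega>. ?F \<omega> \<partial>Samples (k + n))"
    using Samples_permute[OF \<pi> F] m by simp
  also have "\<dots> = (\<integral>x. (\<Sum>l\<le>n. real (n choose l) *
      ((1 - level k x) ^ l * level k x ^ (n - l) * \<Psi> x l)) \<partial>Samples k)"
    by (rule integral_violations[OF \<Psi>_meas \<Psi>_bound])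
  also have "\<dots> = (\<integral>x. (if supp {..<k} x = {..<k} then h (level k x) * level k x ^ n else 0) \<partial>Samples k)"
  proof (intro Bochner_Integration.integral_cong refl)
    fix x
    have "(\<Sum>l\<le>n. real (n choose l) * ((1 - level k x) ^ l * level k x ^ (n - l) * \<Psi> x l)) =
        (\<Sum>l\<le>n. if l = 0 then level k x ^ n * \<Psi> x 0 else 0)"
      by (intro sum.cong) (auto simp: \<Psi>_def)
    then show "(\<Sum>l\<le>n. real (n choose l) * ((1 - level k x) ^ l * level k x ^ (n - l) * \<Psi> x l)) =
        (if supp {..<k} x = {..<k} then h (level k x) * level k x ^ n else 0)"
      by (simp add: \<Psi>_def mult.commute)
  qed
  also have "\<dots> = (\<integral>t. h t * t ^ n \<partial>\<nu> k)"
    by (rule integral_\<nu>[symmetric]) measurable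
  finally show ?thesis by (simp add: k_def n_def)
qed

text \<open>The sample space is split by the value \<open>S\<close> of the support set. By
  \<open>integral_supp_eq\<close> the contribution of \<open>S\<close> depends on its cardinality
  only, which produces the binomial coefficients; \<open>zeta_bound\<close> discards the larger sets
  almost surely.\<close>

lemma integral_card_supp_level:
  fixes h :: "nat \<Rightarrow> real \<Rightarrow> real"
  assumes h [measurable]: "\<And>k. h k \<in> borel_measurable borel"
    and bound: "\<And>k t. t \<in> {0..1} \<Longrightarrow> \<bar>h k t\<bar> \<le> C"
  shows "(\<integral>\<omega>. h (card (supp {..<m} \<omega>)) (level m \<omega>) \<partial>Samples m) =
    (\<Sum>k\<le>\<zeta>. real (m choose k) * (\<integral>t. h k t * t ^ (m - k) \<partial>\<nu> k))"
proof -
  interpret S: prob_space "Samples m" by (rule prob_space_Samples)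
  let ?g = "\<lambda>S \<omega>. if card S \<le> \<zeta> then if supp {..<m} \<omega> = S then h (card S) (level m \<omega>) else 0 else 0"
  have g_meas: "?g S \<in> borel_measurable (Samples m)" if "S \<subseteq> {..<m}" for S
    using supp_eq_measurable[OF that] by measurable
  have C: "0 \<le> C" using bound[of 0 0] by simp
  have g_int: "integrable (Samples m) (?g S)" if "S \<subseteq> {..<m}" for S
    using bound[OF level_in_unit] C
    by (intro S.integrable_const_bound[of _ C, OF _ g_meas[OF that]]) auto
  have "(\<integral>\<omega>. h (card (supp {..<m} \<omega>)) (level m \<omega>) \<partial>Samples m) =
      (\<integral>\<omega>. (\<Sum>S\<in>Pow {..<m}. ?g S \<omega>) \<partial>Samples m)"
  proof (rule integral_cong_AE)
    show "(\<lambda>\<omega>. h (card (supp {..<m} \<omega>)) (level m \<omega>)) \<in> borel_measurable (Samples m)"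
      by (rule measurable_compose_countable[OF _ card_supp_measurable]) measurable
    show "(\<lambda>\<omega>. \<Sum>S\<in>Pow {..<m}. ?g S \<omega>) \<in> borel_measurable (Samples m)"
      using g_meas by (intro borel_measurable_sum) auto
    show "AE \<omega> in Samples m. h (card (supp {..<m} \<omega>)) (level m \<omega>) = (\<Sum>S\<in>Pow {..<m}. ?g S \<omega>)"
      using zeta_bound
    proof eventually_elim
      case (elim \<omega>)
      have "(\<Sum>S\<in>Pow {..<m}. ?g S \<omega>) =
          (\<Sum>S\<in>Pow {..<m}. if supp {..<m} \<omega> = S then h (card S) (level m \<omega>) else 0)"
        using elim by (intro sum.cong) auto
      also have "\<dots> = h (card (supp {..<m} \<omega>)) (level m \<omega>)"
        using support_constraints_subset[of X J f "{..<m}" \<omega>] by simp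
      finally show ?case by simp
    qed
  qed
  also have "\<dots> = (\<Sum>S\<in>Pow {..<m}. \<integral>\<omega>. ?g S \<omega> \<partial>Samples m)"
    using g_int by (intro Bochner_Integration.integral_sum) auto
  also have "\<dots> = (\<Sum>S\<in>Pow {..<m}.
      (\<lambda>k. if k \<le> \<zeta> then \<integral>t. h k t * t ^ (m - k) \<partial>\<nu> k else 0) (card S))"
    using integral_supp_eq[OF _ h bound] by (intro sum.cong) auto
  also have "\<dots> = (\<Sum>k\<le>m. real (m choose k) *
      (if k \<le> \<zeta> then \<integral>t. h k t * t ^ (m - k) \<partial>\<nu> k else 0))"
    by (subst sum_Pow_by_card) auto
  \<comment> \<open>The range \<open>{..m + \<zeta>}\<close> contains both \<open>{..m}\<close> and
    \<open>{..\<zeta>}\<close>: terms with \<open>k > m\<close> vanish by the binomial coefficient,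
    those with \<open>k > \<zeta>\<close> by the conditional.\<close>
  also have "\<dots> = (\<Sum>k\<le>m + \<zeta>. real (m choose k) *
      (if k \<le> \<zeta> then \<integral>t. h k t * t ^ (m - k) \<partial>\<nu> k else 0))"
    by (intro sum.mono_neutral_left) auto
  also have "\<dots> = (\<Sum>k\<le>\<zeta>. real (m choose k) *
      (if k \<le> \<zeta> then \<integral>t. h k t * t ^ (m - k) \<partial>\<nu> k else 0))"
    by (intro sum.mono_neutral_right) auto
  finally show ?thesis by simp
qed

text \<open>Total probability: the case of constant \<open>h\<close>.\<close>

lemma moments_\<nu>: "(\<Sum>k\<le>\<zeta>. real (m choose k) * (\<integral>t. t ^ (m - k) \<partial>\<nu> k)) = 1"
proof -
  interpret S: prob_space "Samples m" by (rule prob_space_Samples)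
  show ?thesis
    using integral_card_supp_level[of "\<lambda>_ _. 1" 1 m] by (simp add: S.prob_space)
qed

text \<open>First the \<open>M\<close> validation scenarios are integrated out for a fixed design
  sample, which gives the binomial sum over \<open>l\<close>; then the design sample is decomposed
  by its support set, which gives the factor \<open>t ^ (N - k)\<close> and the measures
  \<open>\<nu> k\<close>.\<close>

lemma prob_violation_exceeds:
  "measure (Samples (N + M)) {\<omega> \<in> space (Samples (N + M)).
      violation_prob P f (sol {..<N} \<omega>) >
      \<epsilon> (card (supp {..<N} \<omega>)) (num_violated P f M (\<lambda>l. \<omega> (N + l)) (sol {..<N} \<omega>))} =
    (\<Sum>k\<le>\<zeta>. real (N choose k) * (\<integral>t. (\<Sum>l\<le>M. real (M choose l) *
        ((1 - t) ^ l * t ^ (M - l) * indicator {0..<1 - \<epsilon> k l} t)) * t ^ (N - k) \<partial>\<nu> k))"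
    (is "measure _ ?E = (\<Sum>k\<le>\<zeta>. real (N choose k) * (\<integral>t. ?q k t * t ^ (N - k) \<partial>\<nu> k))")
proof -
  \<comment> \<open>A violation probability above \<open>\<epsilon>\<close> means a level below
    \<open>1 - \<epsilon>\<close>; the lower bound 0 holds by \<open>level_in_unit\<close>.\<close>
  define \<Psi> :: "(nat \<Rightarrow> 'd) \<Rightarrow> nat \<Rightarrow> real"
    where "\<Psi> x l = indicator {0..<1 - \<epsilon> (card (supp {..<N} x)) l} (level N x)" for x l
  have \<Psi>_meas: "(\<lambda>x. \<Psi> x l) \<in> borel_measurable (Samples N)" for l
    unfolding \<Psi>_def by (rule measurable_compose_countable[OF _ card_supp_measurable]) measurable
  have E: "indicator ?E \<omega> = \<Psi> (restrict \<omega> {..<N}) (violations N M \<omega>)"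
    if \<omega>: "\<omega> \<in> space (Samples (N + M))" for \<omega>
  proof -
    have "num_violated P f M (\<lambda>l. \<omega> (N + l)) (sol {..<N} \<omega>) =
        card {l \<in> {..<M}. f (sol {..<N} \<omega>) (\<omega> (N + l)) > 0}"
    proof -
      have "indicator (violation_set P f (sol {..<N} \<omega>)) (\<omega> (N + l)) =
          (if f (sol {..<N} \<omega>) (\<omega> (N + l)) > 0 then 1 else 0 :: nat)" if "l \<in> {..<M}" for l
      proof -
        have "\<omega> (N + l) \<in> space P" using Samples_space[OF \<omega> order_refl] that by auto
        then show ?thesis by (simp add: indicator_def violation_set_def)
      qed
      then have "num_violated P f M (\<lambda>l. \<omega> (N + l)) (sol {..<N} \<omega>) =
          (\<Sum>l<M. if f (sol {..<N} \<omega>) (\<omega> (N + l)) > 0 then 1 else 0)"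
        unfolding num_violated_def by (intro sum.cong refl)
      also have "\<dots> = card {l \<in> {..<M}. f (sol {..<N} \<omega>) (\<omega> (N + l)) > 0}"
        by (simp add: Int_def flip: sum.inter_filter)
      finally show ?thesis .
    qed
    also have "\<dots> = violations N M \<omega>"
      unfolding violations_def
      by (rule bij_betw_same_card[of "\<lambda>l. N + l"], rule bij_betw_byWitness[where f' = "\<lambda>j. j - N"]) auto
    finally have "num_violated P f M (\<lambda>l. \<omega> (N + l)) (sol {..<N} \<omega>) = violations N M \<omega>" .
    moreover have "supp {..<N} (restrict \<omega> {..<N}) = supp {..<N} \<omega>"
      "level N (restrict \<omega> {..<N}) = level N \<omega>"
      by (rule support_constraints_cong level_cong; simp)+
    ultimately show ?thesis
      using \<omega> level_in_unit[of N \<omega>] unfolding \<Psi>_def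
      by (simp add: level_def indicator_def less_diff_eq diff_less_eq add.commute)
  qed
  \<comment> \<open>A crude bound, independent of \<open>k\<close>, because
    \<open>integral_card_supp_level\<close> asks for one constant for all \<open>k\<close>.\<close>
  have bound: "\<bar>?q k t\<bar> \<le> (\<Sum>l\<le>M. real (M choose l))" if "t \<in> {0..1}" for k t
  proof -
    have "\<bar>(1 - t) ^ l * t ^ (M - l) * indicator {0..<1 - \<epsilon> k l} t\<bar> \<le> 1" for l
      using that by (auto simp: indicator_def abs_mult intro!: mult_le_one power_le_one)
    then have "\<bar>real (M choose l) * ((1 - t) ^ l * t ^ (M - l) * indicator {0..<1 - \<epsilon> k l} t)\<bar>
        \<le> real (M choose l)" for l
      by (simp add: abs_mult mult_left_le)
    then show ?thesis by (intro order_trans[OF sum_abs] sum_mono)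
  qed
  have "measure (Samples (N + M)) ?E = (\<integral>\<omega>. indicator ?E \<omega> \<partial>Samples (N + M))"
  proof -
    have "?E \<inter> space (Samples (N + M)) = ?E" by blast
    then show ?thesis by (simp only: Bochner_Integration.integral_indicator)
  qed
  also have "\<dots> = (\<integral>\<omega>. \<Psi> (restrict \<omega> {..<N}) (violations N M \<omega>) \<partial>Samples (N + M))"
    using E by (intro Bochner_Integration.integral_cong) auto
  also have "\<dots> = (\<integral>x. ?q (card (supp {..<N} x)) (level N x) \<partial>Samples N)"
    by (subst integral_violations[where C = 1, OF \<Psi>_meas]) (auto simp: \<Psi>_def indicator_def)
  also have "\<dots> = (\<Sum>k\<le>\<zeta>. real (N choose k) * (\<integral>t. ?q k t * t ^ (N - k) \<partial>\<nu> k))"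
    using bound by (intro integral_card_supp_level) auto
  finally show ?thesis .
qed

end

section \<open>The variational problem and the final bound\<close>

text \<open>On the interval every derivative of \<open>C * exp\<close> is at least \<open>C\<close>,
  so it suffices that \<open>C\<close> dominates each left-hand side multiplied by
  \<open>fact k\<close>. The sum over \<open>k\<close> is a convenient such constant.\<close>

lemma var_feasible_nonempty: "var_feasible \<zeta> N M \<epsilon> \<noteq> {}"
proof -
  define C where "C = (\<Sum>k\<le>\<zeta>. fact k * (real (N choose k) * (\<Sum>l=0..M. real (M choose l))))"
  have "real (N choose k) * t ^ (N - k) *
          (\<Sum>l=0..M. real (M choose l) * t ^ (M - l) * (1 - t) ^ l * indicator {0..<1 - \<epsilon> k l} t)
        \<le> 1 / fact k * nth_deriv01 k (\<lambda>x. C * exp x) t"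
    if t: "t \<in> {0..1}" and k: "k \<le> \<zeta>" for t k
  proof -
    have *: "t ^ (M - l) * ((1 - t) ^ l * indicator {0..<1 - \<epsilon> k l} t) \<le> 1" for l
      using t by (auto simp: indicator_def intro!: mult_le_one power_le_one)
    have "real (N choose k) * t ^ (N - k) *
          (\<Sum>l=0..M. real (M choose l) * t ^ (M - l) * (1 - t) ^ l * indicator {0..<1 - \<epsilon> k l} t)
        \<le> real (N choose k) * 1 * (\<Sum>l=0..M. real (M choose l))"
      using t * unfolding mult.assoc
      by (intro mult_mono mult_nonneg_nonneg sum_nonneg sum_mono mult_left_le power_le_one) auto
    also have "fact k * \<dots> \<le> C"
      unfolding C_def mult_1_right using k
      by (intro member_le_sum[of k _ "\<lambda>k. fact k * (real (N choose k) * (\<Sum>l=0..M. real (M choose l)))"])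
        (auto intro!: mult_nonneg_nonneg sum_nonneg)
    then have "real (N choose k) * 1 * (\<Sum>l=0..M. real (M choose l)) \<le> 1 / fact k * C"
      by (simp add: field_simps)
    also have "\<dots> \<le> 1 / fact k * (C * exp t)"
    proof -
      have "0 \<le> C" unfolding C_def by (auto intro!: sum_nonneg mult_nonneg_nonneg)
      then have "C * 1 \<le> C * exp t" using t by (intro mult_left_mono) auto
      then show ?thesis by (simp add: divide_right_mono)
    qed
    finally show ?thesis using nth_deriv01_scaled_exp[OF t] by simp
  qed
  then have "(\<lambda>x. C * exp x) \<in> var_feasible \<zeta> N M \<epsilon>"
    using scaled_exp_in_C01 unfolding var_feasible_def by blast
  then show ?thesis by blast
qed

theorem theorem3:
  fixes P :: "'d measure"
    and X :: "(real ^ 'n) set"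
    and J :: "real ^ 'n \<Rightarrow> real"
    and f :: "real ^ 'n \<Rightarrow> 'd \<Rightarrow> real"
    and \<zeta> N M :: nat
    and \<epsilon> :: "nat \<Rightarrow> nat \<Rightarrow> real"
  assumes prob: "prob_space P"
    and X: "convex X" "closed X"
    and J: "convex_on UNIV J"
    and f_convex: "\<And>\<delta>. \<delta> \<in> space P \<Longrightarrow> convex_on UNIV (\<lambda>x. f x \<delta>)"
    and f_lsc: "\<And>\<delta>. \<delta> \<in> space P \<Longrightarrow> lower_semicontinuous (\<lambda>x. f x \<delta>)"
    and feasibility_uniqueness:
      "\<And>m \<omega>. \<omega> \<in> space (PiM {..<m} (\<lambda>_. P)) \<Longrightarrow> \<exists>!x. sp_optimal X J f {..<m} \<omega> x"
    and measurable_violation: "\<And>x. x \<in> X \<Longrightarrow> violation_set P f x \<in> sets P"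
    and measurable_solution_violation:
      "\<And>m. {(\<omega>, \<delta>) \<in> space (PiM {..<m} (\<lambda>_. P) \<Otimes>\<^sub>M P). f (sp_solution X J f {..<m} \<omega>) \<delta> > 0}
             \<in> sets (PiM {..<m} (\<lambda>_. P) \<Otimes>\<^sub>M P)"
    and non_degeneracy:
      "\<And>m. AE \<omega> in PiM {..<m} (\<lambda>_. P).
         sp_solution X J f {..<m} \<omega> =
         sp_solution X J f (support_constraints X J f {..<m} \<omega>) \<omega>"
    and zeta_le: "\<zeta> \<le> CARD('n)"
    and zeta_bound:
      "\<And>m. AE \<omega> in PiM {..<m} (\<lambda>_. P). card (support_constraints X J f {..<m} \<omega>) \<le> \<zeta>"
    and N: "\<zeta> < N"
    and eps: "\<And>k l. k \<le> \<zeta> \<Longrightarrow> l \<le> M \<Longrightarrow> \<epsilon> k l \<in> {0..1}"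
  shows
    "measure (PiM {..<N + M} (\<lambda>_. P))
       {\<omega> \<in> space (PiM {..<N + M} (\<lambda>_. P)).
          violation_prob P f (sp_solution X J f {..<N} \<omega>) >
          \<epsilon> (card (support_constraints X J f {..<N} \<omega>))
            (num_violated P f M (\<lambda>l. \<omega> (N + l)) (sp_solution X J f {..<N} \<omega>))}
     \<le> beta_star \<zeta> N M \<epsilon>"
proof -
  interpret scenario_program P X J f \<zeta>
    using prob feasibility_uniqueness measurable_solution_violation non_degeneracy zeta_bound
    by (simp add: scenario_program_def scenario_program_axioms_def)
  let ?\<phi> = "\<lambda>k t. real (N choose k) * t ^ (N - k) *
    (\<Sum>l=0..M. real (M choose l) * t ^ (M - l) * (1 - t) ^ l * indicator {0..<1 - \<epsilon> k l} t)"
  \<comment> \<open>On the unit interval, where \<open>\<nu> k\<close> is concentrated, the powers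
    and the indicator are at most 1, so only binomial coefficients remain in the bound.\<close>
  have \<phi>_int: "integrable (\<nu> k) (?\<phi> k)" for k
  proof (rule finite_measure.integrable_const_bound[OF finite_measure_\<nu>])
    show "AE t in \<nu> k. norm (?\<phi> k t) \<le> real (N choose k) * (\<Sum>l=0..M. real (M choose l))"
      using AE_\<nu>[of k]
    proof eventually_elim
      case (elim t)
      have "\<bar>t ^ (M - l) * ((1 - t) ^ l * indicator {0..<1 - \<epsilon> k l} t)\<bar> \<le> 1" for l
        using elim by (auto simp: indicator_def abs_mult intro!: mult_le_one power_le_one)
      then have "\<bar>\<Sum>l=0..M. real (M choose l) * (t ^ (M - l) * ((1 - t) ^ l * indicator {0..<1 - \<epsilon> k l} t))\<bar>
          \<le> (\<Sum>l=0..M. real (M choose l))"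
        by (intro order_trans[OF sum_abs] sum_mono) (simp add: abs_mult mult_left_le)
      moreover have "\<bar>t ^ (N - k)\<bar> \<le> 1"
        using elim by (simp add: power_abs power_le_one)
      ultimately have "\<bar>t ^ (N - k)\<bar> * \<bar>\<Sum>l=0..M. real (M choose l) *
          (t ^ (M - l) * ((1 - t) ^ l * indicator {0..<1 - \<epsilon> k l} t))\<bar> \<le> 1 * (\<Sum>l=0..M. real (M choose l))"
        by (intro mult_mono) auto
      then show ?case by (simp add: abs_mult mult.assoc mult_left_mono)
    qed
  qed measurable
  have "(\<Sum>k\<le>\<zeta>. \<integral>t. ?\<phi> k t \<partial>\<nu> k) \<le> g 1" if "g \<in> var_feasible \<zeta> N M \<epsilon>" for g
    using that
    by (intro weak_duality[OF finite_measure_\<nu> sets_\<nu> AE_\<nu> moments_\<nu> \<phi>_int])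
      (auto simp: var_feasible_def)
  \<comment> \<open>Up to the order of factors, the summands of
    \<open>prob_violation_exceeds\<close> are the integrals of the left-hand sides of the
    constraints.\<close>
  moreover have "real (N choose k) * (\<integral>t. (\<Sum>l\<le>M. real (M choose l) *
        ((1 - t) ^ l * t ^ (M - l) * indicator {0..<1 - \<epsilon> k l} t)) * t ^ (N - k) \<partial>\<nu> k) =
      (\<integral>t. ?\<phi> k t \<partial>\<nu> k)" for k
    unfolding integral_mult_right_zero[symmetric] atMost_atLeast0
    by (intro Bochner_Integration.integral_cong refl)
      (simp only: sum_distrib_left sum_distrib_right ac_simps)
  \<comment> \<open>The probability is thus a lower bound for all feasible values
    \<open>g 1\<close>; nonemptiness lets it pass to the real infimum.\<close>
  ultimately show ?thesis
    unfolding prob_violation_exceeds beta_star_def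
    by (intro cINF_greatest var_feasible_nonempty) simp
qed

end
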